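(* Let $f\in C((0,\infty);(0,\infty))$ be increasing and locally Lipschitz continuous, such that $x\mapsto f(x)/x$ is increasing on $[x_0,\infty)$ for some $x_0>0$ and $\lim_{x\to\infty} f(x)/x=\infty$, and suppose $\int_1^\infty \frac{du}{f(u)}=\infty$. Let $h\in C((0,\infty);\mathbb{R})$ be such that $H(t)=\int_0^t h(s)\,ds$ is well defined and $H(t)\ge 0$ for every $t\ge 0$. Let $\psi>0$ and let $x$ be the unique continuous solution on $[0,\infty)$ of $$x'(t)=f(x(t))+h(t),\quad t\ge 0;\qquad x(0)=\psi.$$ Suppose that $H$ is asymptotic to an increasing function $\tilde H:[0,\infty)\to[0,\infty)$, i.e. $\lim_{t\to\infty}H(t)/\tilde H(t)=1$. (a) If there is some $K>1$ such that $$\lim_{t\to\infty}\frac{\int_0^t f(K\tilde H(s))\,ds}{\tilde H(t)}=0,$$ then $\lim_{t\to\infty}\dfrac{x(t)}{H(t)}=1$. (b) Conversely, if $\lim_{t\to\infty}\dfrac{x(t)}{H(t)}=1$, then $$\lim_{t\to\infty}\frac{\int_0^t f(H(s))\,ds}{H(t)}=0.$$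
   Context: The differential equation is understood in integrated form: $x(t)=\psi+H(t)+\int_0^t f(x(s))\,ds$ for $t\ge 0$. The condition $\int_1^\infty du/f(u)=\infty$ guarantees that the solution is defined on all of $[0,\infty)$. Where $f$ is evaluated at $0$, use the convention $f(0)=\lim_{y\to0^+}f(y)$, which exists because $f$ is increasing and positive. *)

theory Defs
  imports "HOL-Analysis.Analysis"
begin

text \<open>A function given on the open half-line is extended to \<open>0\<close> by its right limit there.\<close>

definition ext_at_0 :: "(real \<Rightarrow> real) \<Rightarrow> real \<Rightarrow> real" where
  "ext_at_0 f y = (if y = 0 then Lim (at_right 0) f else f y)"

text \<open>Continuous solution on the closed half-line of \<open>x' = f(x) + h\<close>, \<open>x(0) = \<psi>\<close>, in integrated
  form, where \<open>H\<close> is the integral of \<open>h\<close> from \<open>0\<close>. Since \<open>H 0 = 0\<close>, the initial condition is the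
  case \<open>t = 0\<close>. Positivity says that \<open>x\<close> stays in the domain of \<open>f\<close>.\<close>

definition is_solution ::
  "(real \<Rightarrow> real) \<Rightarrow> (real \<Rightarrow> real) \<Rightarrow> real \<Rightarrow> (real \<Rightarrow> real) \<Rightarrow> bool" where
  "is_solution f H \<psi> x \<longleftrightarrow>
     continuous_on {0..} x \<and> (\<forall>t\<ge>0. x t > 0) \<and>
     (\<forall>t\<ge>0. x t = \<psi> + H t + integral {0..t} (\<lambda>s. f (x s)))"

end

theory Submission
  imports Defs
begin

text \<open>
  Write \<open>I(t)\<close> for the integral of \<open>f \<circ> x\<close> and \<open>J(t)\<close> for that of \<open>f \<circ> (K Ht)\<close> over \<open>[0,t]\<close>, so
  that \<open>x = \<psi> + H + I\<close>. Part (b) holds because \<open>H \<le> x\<close> gives \<open>\<integral> f \<circ> H \<le> I \<le> x - H\<close>.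

  For part (a) it suffices that \<open>x \<le> K Ht\<close> eventually, since then \<open>I \<le> const + J = o(Ht)\<close>.
  If \<open>I \<le> \<delta> Ht\<close> holds at one late time, for small \<open>\<delta>\<close>, then \<open>x \<le> K Ht\<close> persists from there on: up
  to a first violation \<open>I\<close> grows no faster than \<open>J\<close>, which is negligible. Such a time exists, as
  otherwise \<open>x \<le> B I\<close> and \<open>I' \<le> f(B I)\<close> for a constant \<open>B\<close>, whereas \<open>J = o(Ht)\<close> forces
  \<open>J' \<ge> f(M J)\<close> for every \<open>M\<close>; comparison through an antiderivative of \<open>1 / f\<close> then makes \<open>M J\<close>
  exceed \<open>B I > B \<delta> Ht\<close>, contradicting \<open>J = o(Ht)\<close>.
\<close>

section \<open>First crossings, one-variable calculus and a comparison principle for differential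
  inequalities\<close>

text \<open>The level set of \<open>k\<close> in \<open>{a..b}\<close> is compact, and
  \<open>\<tau>\<close> is its least point. A value above \<open>k\<close> before
  \<open>\<tau>\<close> would, by the intermediate value theorem, produce a smaller point of the
  level set.\<close>

lemma first_crossing:
  fixes g :: "real \<Rightarrow> real"
  assumes cont: "continuous_on {a..b} g" and "a \<le> b" "g a < k" "k \<le> g b"
  obtains \<tau> where "a \<le> \<tau>" "\<tau> \<le> b" "g \<tau> = k" "\<And>s. a \<le> s \<Longrightarrow> s \<le> \<tau> \<Longrightarrow> g s \<le> k"
proof -
  define S where "S = {a..b} \<inter> g -` {k}"
  have "closed S"
    unfolding S_def using cont by (intro continuous_closed_preimage) auto
  moreover have "S \<subseteq> {a..b}" by (auto simp: S_def)
  ultimately have "compact S"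
    by (meson bounded_closed_interval bounded_subset compact_eq_bounded_closed)
  moreover have "S \<noteq> {}"
    using IVT'[of g a k b] assms by (auto simp: S_def)
  ultimately obtain \<tau> where \<tau>: "\<tau> \<in> S" "\<And>s. s \<in> S \<Longrightarrow> \<tau> \<le> s"
    using compact_attains_inf by metis
  show ?thesis
  proof (rule that[of \<tau>])
    fix s assume s: "a \<le> s" "s \<le> \<tau>"
    show "g s \<le> k"
    proof (rule ccontr)
      assume "\<not> g s \<le> k"
      moreover have "continuous_on {a..s} g"
        by (rule continuous_on_subset[OF cont]) (use s \<tau>(1) in \<open>auto simp: S_def\<close>)
      ultimately obtain r where r: "a \<le> r" "r \<le> s" "g r = k"
        using IVT'[of g a k s] assms s by auto
      then have "r \<in> S" using s \<tau>(1) by (auto simp: S_def)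
      then have "r = s" using \<tau>(2)[of r] r s by auto
      then show False using r \<open>\<not> g s \<le> k\<close> by simp
    qed
  qed (use \<tau> in \<open>auto simp: S_def\<close>)
qed

lemma continuous_on_atLeast:
  fixes k :: "real \<Rightarrow> 'a::topological_space"
  assumes "\<And>b. continuous_on {a..b} k"
  shows "continuous_on {a..} k"
  unfolding continuous_on_def
proof
  fix t assume "t \<in> {a..}"
  then have "(k \<longlongrightarrow> k t) (at t within {a..t + 1})"
    using assms[of "t + 1"] by (simp add: continuous_on_def)
  moreover have "at t within {a..t + 1} = at t within {a..}"
    by (rule at_within_nhd[of t "{..<t + 1}"]) auto
  ultimately show "(k \<longlongrightarrow> k t) (at t within {a..})" by simp
qed

lemma integral_has_real_derivative_at:
  fixes k :: "real \<Rightarrow> real"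
  assumes "continuous_on {a..} k" and "a < t"
  shows "((\<lambda>t. integral {a..t} k) has_real_derivative k t) (at t)"
proof -
  have "((\<lambda>t. integral {a..t} k) has_real_derivative k t) (at t within {a..t+1})"
    by (rule integral_has_real_derivative)
      (use assms in \<open>auto intro: continuous_on_subset\<close>)
  moreover have "at t within {a..t+1} = at t"
    using assms(2) by (intro at_within_interior) auto
  ultimately show ?thesis by simp
qed

text \<open>With \<open>F' = 1 / f\<close>, the function \<open>F \<circ> u - F \<circ> v\<close> grows at least linearly.\<close>

lemma eventually_less_if_deriv_separated:
  fixes f u v u' v' :: "real \<Rightarrow> real"
  assumes f: "continuous_on {0<..} f" "\<And>y. y > 0 \<Longrightarrow> f y > 0"
    and u: "\<And>t. t \<ge> a \<Longrightarrow> u t > 0" "\<And>t. t \<ge> a \<Longrightarrow> (u has_real_derivative u' t) (at t)"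
      "\<And>t. t \<ge> a \<Longrightarrow> u' t \<ge> M * f (u t)"
    and v: "\<And>t. t \<ge> a \<Longrightarrow> v t > 0" "\<And>t. t \<ge> a \<Longrightarrow> (v has_real_derivative v' t) (at t)"
      "\<And>t. t \<ge> a \<Longrightarrow> v' t \<le> B * f (v t)"
    and "B < M"
  shows "eventually (\<lambda>t. v t < u t) at_top"
proof -
  have "\<exists>F. \<forall>y. ereal 0 < ereal y \<longrightarrow> ereal y < \<infinity> \<longrightarrow> (F has_vector_derivative 1 / f y) (at y)"
  proof (rule einterval_antiderivative)
    fix y assume "ereal 0 < ereal y" "ereal y < \<infinity>"
    then have y: "y > 0" by simp
    have "isCont f y"
      using f(1) y by (simp add: continuous_on_eq_continuous_at)
    then show "isCont (\<lambda>y. 1 / f y) y"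
      using f(2)[OF y] by (intro continuous_intros) auto
  qed simp
  then obtain F where F: "\<And>y. y > 0 \<Longrightarrow> (F has_real_derivative 1 / f y) (at y)"
    by (auto simp: has_real_derivative_iff_has_vector_derivative)
  have F_strict: "F y < F z" if "0 < y" "y < z" for y z
  proof (rule DERIV_pos_imp_increasing[OF that(2)])
    fix w assume "y \<le> w" "w \<le> z"
    then have "w > 0" using that by simp
    then show "\<exists>d. (F has_real_derivative d) (at w) \<and> 0 < d"
      using F f(2) by (intro exI[of _ "1 / f w"]) auto
  qed
  \<comment> \<open>The linear term is the growth guaranteed by the hypotheses: the two chain-rule
    terms are at least \<open>M\<close> and at most \<open>B\<close>, so
    \<open>D' \<ge> M - B - (M - B) = 0\<close>.\<close>
  define D where "D t = F (u t) - F (v t) - (M - B) * t" for t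
  have D_mono: "D a \<le> D t" if "a \<le> t" for t
  proof (rule DERIV_nonneg_imp_nondecreasing[OF that])
    fix s assume "a \<le> s" "s \<le> t"
    have Fu: "((\<lambda>s. F (u s)) has_real_derivative 1 / f (u s) * u' s) (at s)"
      using DERIV_chain2[OF F u(2)] u(1) \<open>a \<le> s\<close> by blast
    have Fv: "((\<lambda>s. F (v s)) has_real_derivative 1 / f (v s) * v' s) (at s)"
      using DERIV_chain2[OF F v(2)] v(1) \<open>a \<le> s\<close> by blast
    have "(D has_real_derivative 1 / f (u s) * u' s - 1 / f (v s) * v' s - (M - B)) (at s)"
      unfolding D_def by (rule derivative_eq_intros Fu Fv refl | simp)+
    moreover have "M \<le> 1 / f (u s) * u' s"
      using u(3)[OF \<open>a \<le> s\<close>] f(2)[OF u(1)[OF \<open>a \<le> s\<close>]] by (simp add: field_simps)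
    moreover have "1 / f (v s) * v' s \<le> B"
      using v(3)[OF \<open>a \<le> s\<close>] f(2)[OF v(1)[OF \<open>a \<le> s\<close>]] by (simp add: field_simps)
    ultimately show "\<exists>y. (D has_real_derivative y) (at s) \<and> 0 \<le> y"
      by (intro exI conjI) (assumption, linarith)
  qed
  \<comment> \<open>Past the threshold \<open>- D a / (M - B)\<close> the linear growth outweighs a
    possibly negative \<open>D a\<close>; strict monotonicity of \<open>F\<close> then carries the
    inequality back to \<open>v\<close> and \<open>u\<close>.\<close>
  show ?thesis
    using eventually_gt_at_top[of "max a (- D a / (M - B))"]
  proof eventually_elim
    case (elim t)
    then have t: "a \<le> t" and "- D a / (M - B) < t" by auto
    then have "0 < D a + (M - B) * t"
      using \<open>B < M\<close> by (simp add: field_simps)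
    then have "F (v t) < F (u t)"
      using D_mono[OF t] by (simp add: D_def)
    then show "v t < u t"
      using F_strict[of "u t" "v t"] u(1)[OF t] by (metis less_asym' not_less_iff_gr_or_eq)
  qed
qed

section \<open>The extension of \<open>f\<close> by its right limit at 0\<close>

text \<open>By monotonicity the right limit is the infimum of \<open>f\<close> over the positive
  reals, finite because \<open>f\<close> is positive. So \<open>Lim\<close> yields a genuine limit
  here and not an unspecified value.\<close>

lemma tendsto_ext_at_0:
  assumes "\<And>y. y > 0 \<Longrightarrow> f y > 0" and "mono_on {0<..} f"
  shows "(f \<longlongrightarrow> ext_at_0 f 0) (at_right 0)"
proof -
  define L where "L = Inf (f ` {0<..})"
  have bdd: "bdd_below (f ` {0<..})"
    by (rule bdd_belowI[of _ 0]) (use assms(1) in \<open>auto intro: less_imp_le\<close>)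
  have "(f \<longlongrightarrow> L) (at_right 0)"
  proof (rule order_tendstoI)
    fix c assume "c < L"
    have "c < f y" if "y > 0" for y
      using \<open>c < L\<close> cInf_lower[OF _ bdd, of "f y"] that unfolding L_def by force
    then show "\<forall>\<^sub>F y in at_right 0. c < f y"
      by (simp add: eventually_at_filter)
  next
    fix c assume "L < c"
    then obtain z where z: "z > 0" "f z < c"
      unfolding L_def by (subst (asm) cInf_less_iff[OF _ bdd]) auto
    have "f y < c" if "0 < y" "y < z" for y
      using mono_onD[OF assms(2), of y z] z that by auto
    then show "\<forall>\<^sub>F y in at_right 0. f y < c"
      unfolding eventually_at_right_field using z by blast
  qed
  then show ?thesis
    using tendsto_Lim[of "at_right 0" f L] by (simp add: ext_at_0_def)
qed

lemma ext_at_0_nonneg: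
  assumes "\<And>y. y > 0 \<Longrightarrow> f y > 0" and "mono_on {0<..} f" and "y \<ge> 0"
  shows "ext_at_0 f y \<ge> 0"
proof (cases "y = 0")
  case True
  have "eventually (\<lambda>z. 0 \<le> f z) (at_right 0)"
    using assms(1) by (auto simp: eventually_at_filter intro!: always_eventually less_imp_le)
  with True show ?thesis
    using tendsto_lowerbound[OF tendsto_ext_at_0[OF assms(1,2)]] by simp
qed (use assms in \<open>auto simp: ext_at_0_def intro: less_imp_le\<close>)

lemma mono_on_ext_at_0:
  assumes "\<And>y. y > 0 \<Longrightarrow> f y > 0" and "mono_on {0<..} f"
  shows "mono_on {0..} (ext_at_0 f)"
proof (rule mono_onI)
  fix y z :: real assume yz: "y \<in> {0..}" "z \<in> {0..}" "y \<le> z"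
  show "ext_at_0 f y \<le> ext_at_0 f z"
  proof (cases "y = 0 \<and> z > 0")
    case True
    have "eventually (\<lambda>w. f w \<le> f z) (at_right 0)"
      unfolding eventually_at_right_field
      using mono_onD[OF assms(2), of _ z] True by (intro exI[of _ z]) auto
    then have "ext_at_0 f 0 \<le> f z"
      using tendsto_upperbound[OF tendsto_ext_at_0[OF assms]] by simp
    with True show ?thesis by (simp add: ext_at_0_def)
  next
    case False
    then show ?thesis
      using yz mono_onD[OF assms(2), of y z] by (auto simp: ext_at_0_def)
  qed
qed

section \<open>Setting for part (a) and basic properties of \<open>I\<close> and
  \<open>J\<close>\<close>

text \<open>Neither \<open>H\<close> nor \<open>\<psi>\<close> nor the equation occurs here. The
  equation enters later through a single eventual bound of the form
  \<open>x t \<le> C * Ht t + I t\<close>.\<close>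

locale dominated_solution =
  fixes f x Ht :: "real \<Rightarrow> real" and K :: real and I J :: "real \<Rightarrow> real"
  defines "I \<equiv> \<lambda>t. integral {0..t} (\<lambda>s. f (x s))"
    and "J \<equiv> \<lambda>t. integral {0..t} (\<lambda>s. ext_at_0 f (K * Ht s))"
  assumes f_cont: "continuous_on {0<..} f"
    and f_pos: "\<And>y. y > 0 \<Longrightarrow> f y > 0"
    and f_mono: "mono_on {0<..} f"
    and x_cont: "continuous_on {0..} x"
    and x_pos: "\<And>t. t \<ge> 0 \<Longrightarrow> x t > 0"
    and Ht_nonneg: "\<And>t. t \<ge> 0 \<Longrightarrow> Ht t \<ge> 0"
    and Ht_mono: "mono_on {0..} Ht"
    and Ht_eventually_pos: "eventually (\<lambda>t. Ht t > 0) at_top"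
    and K_gt_1: "K > 1"
    and J_negligible: "((\<lambda>t. J t / Ht t) \<longlongrightarrow> 0) at_top"
begin

lemma f_le: "0 < y \<Longrightarrow> y \<le> z \<Longrightarrow> f y \<le> f z"
  using mono_onD[OF f_mono, of y z] by simp

lemma Ht_le: "0 \<le> s \<Longrightarrow> s \<le> t \<Longrightarrow> Ht s \<le> Ht t"
  using mono_onD[OF Ht_mono, of s t] by simp

lemma continuous_on_f_x: "continuous_on {0..} (\<lambda>s. f (x s))"
  by (rule continuous_on_compose2[OF f_cont x_cont]) (use x_pos in auto)

lemma integrable_f_x: "0 \<le> a \<Longrightarrow> (\<lambda>s. f (x s)) integrable_on {a..b}"
  by (intro integrable_continuous_interval continuous_on_subset[OF continuous_on_f_x]) auto

lemma I_diff: "0 \<le> a \<Longrightarrow> a \<le> b \<Longrightarrow> I b - I a = integral {a..b} (\<lambda>s. f (x s))"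
  unfolding I_def
  using Henstock_Kurzweil_Integration.integral_combine[of 0 a b "\<lambda>s. f (x s)"] integrable_f_x[of 0 b]
  by simp

lemma I_nonneg: "0 \<le> t \<Longrightarrow> 0 \<le> I t"
  unfolding I_def using integrable_f_x[of 0 t]
  by (intro integral_nonneg) (auto intro!: less_imp_le[OF f_pos] x_pos)

text \<open>\<open>Ht\<close> may be discontinuous, so integrability of the integrand of
  \<open>J\<close> is drawn from its monotonicity.\<close>

lemma mono_on_ext_Ht: "mono_on {0..} (\<lambda>s. ext_at_0 f (K * Ht s))"
proof (rule mono_onI)
  fix s t :: real assume "s \<in> {0..}" "t \<in> {0..}" "s \<le> t"
  then show "ext_at_0 f (K * Ht s) \<le> ext_at_0 f (K * Ht t)"
    using K_gt_1 Ht_le[of s t] Ht_nonneg[of s] Ht_nonneg[of t]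
    by (intro mono_onD[OF mono_on_ext_at_0[OF f_pos f_mono]]) auto
qed

lemma integrable_ext_Ht: "0 \<le> a \<Longrightarrow> (\<lambda>s. ext_at_0 f (K * Ht s)) integrable_on {a..b}"
  by (intro integrable_on_mono_on mono_on_subset[OF mono_on_ext_Ht]) auto

lemma J_diff: "0 \<le> a \<Longrightarrow> a \<le> b \<Longrightarrow> J b - J a = integral {a..b} (\<lambda>s. ext_at_0 f (K * Ht s))"
  unfolding J_def
  using Henstock_Kurzweil_Integration.integral_combine[of 0 a b "\<lambda>s. ext_at_0 f (K * Ht s)"]
    integrable_ext_Ht[of 0 b]
  by simp

lemma ext_Ht_nonneg: "0 \<le> s \<Longrightarrow> 0 \<le> ext_at_0 f (K * Ht s)"
  using ext_at_0_nonneg[OF f_pos f_mono] Ht_nonneg K_gt_1 by simp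

lemma J_mono: "0 \<le> a \<Longrightarrow> a \<le> b \<Longrightarrow> J a \<le> J b"
  using J_diff[of a b] integral_nonneg[OF integrable_ext_Ht[of a b]] ext_Ht_nonneg
  by fastforce

lemma J_nonneg: "0 \<le> t \<Longrightarrow> 0 \<le> J t"
  using J_mono[of 0 t] by (simp add: J_def)

lemma ext_Ht_eq: "Ht s > 0 \<Longrightarrow> ext_at_0 f (K * Ht s) = f (K * Ht s)"
  using K_gt_1 by (simp add: ext_at_0_def)

lemma continuous_on_I: "0 \<le> a \<Longrightarrow> continuous_on {a..b} I"
  unfolding I_def
  by (rule continuous_on_subset[OF indefinite_integral_continuous_1[OF integrable_f_x]]) auto

lemma continuous_on_J: "0 \<le> a \<Longrightarrow> continuous_on {a..b} J"
  unfolding J_def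
  by (rule continuous_on_subset[OF indefinite_integral_continuous_1[OF integrable_ext_Ht]]) auto

lemma J_le_Ht:
  assumes "\<eta> > 0"
  shows "eventually (\<lambda>t. J t \<le> \<eta> * Ht t) at_top"
  using order_tendstoD(2)[OF J_negligible assms] Ht_eventually_pos
  by eventually_elim (simp add: field_simps)

section \<open>Divergence of \<open>J\<close> and \<open>Ht\<close>\<close>

text \<open>Once \<open>Ht\<close> is positive, the integrand stays above a positive constant, so
  \<open>J\<close> grows at least linearly.\<close>

lemma J_at_top: "filterlim J at_top at_top"
proof -
  obtain T where T: "T \<ge> 0" "Ht T > 0"
    using eventually_happens'[OF _ eventually_conj[OF Ht_eventually_pos eventually_ge_at_top[of 0]]]
    by auto
  define c where "c = f (K * Ht T)"
  have "c > 0" unfolding c_def using f_pos T K_gt_1 by simp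
  have J_ge: "c * (t - T) \<le> J t" if "t \<ge> T" for t
  proof -
    have "integral {T..t} (\<lambda>s. c) \<le> integral {T..t} (\<lambda>s. ext_at_0 f (K * Ht s))"
      using mono_onD[OF mono_on_ext_Ht, of T] T integrable_ext_Ht
      by (intro integral_le) (auto simp: c_def ext_Ht_eq[symmetric])
    then show ?thesis
      using J_diff[of T t] J_nonneg[of T] that T by (simp add: mult.commute)
  qed
  have "filterlim (\<lambda>t. c * (t - T)) at_top at_top"
    using \<open>c > 0\<close>
    by (intro filterlim_tendsto_pos_mult_at_top[OF tendsto_const])
      (use filterlim_tendsto_add_at_top[OF tendsto_const filterlim_ident, of "- T"] in simp_all)
  then show ?thesis
    by (rule filterlim_at_top_mono)
      (use J_ge in \<open>auto intro: eventually_mono[OF eventually_ge_at_top[of T]]\<close>)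
qed

text \<open>Negligibility gives \<open>J \<le> Ht\<close> eventually, so \<open>Ht\<close> inherits
  the divergence of \<open>J\<close>.\<close>

lemma Ht_at_top: "filterlim Ht at_top at_top"
  by (rule filterlim_at_top_mono[OF J_at_top]) (use J_le_Ht[of 1] in simp)

section \<open>Smallness of \<open>I\<close> relative to \<open>Ht\<close>\<close>

text \<open>Supplies the starting time for the continuation argument in
  \<open>x_eventually_le\<close>. Were \<open>I\<close> eventually above
  \<open>\<delta> * Ht\<close>, the comparison principle would apply with \<open>v = B * I\<close>
  and with \<open>u = M * p\<close> for a minorant \<open>p\<close> of \<open>J\<close>.\<close>

lemma I_frequently_small:
  assumes "C > 0" "\<delta> > 0" and x_le: "eventually (\<lambda>t. x t \<le> C * Ht t + I t) at_top"
  shows "frequently (\<lambda>t. I t \<le> \<delta> * Ht t) at_top"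
proof (rule ccontr)
  assume "\<not> ?thesis"
  then have I_gt: "eventually (\<lambda>t. \<delta> * Ht t < I t) at_top"
    by (simp add: frequently_def not_le)
  \<comment> \<open>\<open>B\<close> is chosen so that \<open>\<delta> * Ht < I\<close> turns
    \<open>x \<le> C * Ht + I\<close> into \<open>x \<le> B * I\<close>; for \<open>M\<close>, any
    constant above \<open>B\<close> would do.\<close>
  define B where "B = 1 + C / \<delta>"
  define M where "M = B + 1"
  have "B > 0" "M > 0" "B < M"
    using assms by (auto simp: B_def M_def add_pos_pos)
  have MJ_le: "eventually (\<lambda>t. J t \<le> 1 / M * Ht t) at_top"
    using \<open>M > 0\<close> by (intro J_le_Ht) simp
  have "eventually (\<lambda>t. \<delta> * Ht t < I t \<and> x t \<le> C * Ht t + I t \<and> M * J t \<le> Ht t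
      \<and> 0 < J t \<and> 0 < Ht t) at_top"
    using I_gt x_le MJ_le Ht_eventually_pos
      filterlim_at_top_dense[THEN iffD1, OF J_at_top, rule_format, of 0]
    by eventually_elim (use \<open>M > 0\<close> in \<open>auto simp: field_simps\<close>)
  then obtain T0 where T0: "\<forall>t\<ge>T0. \<delta> * Ht t < I t \<and> x t \<le> C * Ht t + I t \<and> M * J t \<le> Ht t
      \<and> 0 < J t \<and> 0 < Ht t"
    unfolding eventually_at_top_linorder by blast
  define T where "T = max 0 T0"
  have "T \<ge> 0"
    and T: "\<And>t. t \<ge> T \<Longrightarrow> \<delta> * Ht t < I t" "\<And>t. t \<ge> T \<Longrightarrow> x t \<le> C * Ht t + I t"
      "\<And>t. t \<ge> T \<Longrightarrow> M * J t \<le> Ht t" "\<And>t. t \<ge> T \<Longrightarrow> 0 < J t" "\<And>t. t \<ge> T \<Longrightarrow> 0 < Ht t"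
    using T0 by (auto simp: T_def)
  have I_pos: "I t > 0" if "t \<ge> T" for t
    using T(1,5)[OF that] \<open>\<delta> > 0\<close> by (meson less_trans mult_pos_pos)
  have x_le_BI: "x t \<le> B * I t" if "t \<ge> T" for t
  proof -
    have "C * Ht t = C / \<delta> * (\<delta> * Ht t)" using \<open>\<delta> > 0\<close> by simp
    also have "\<dots> \<le> C / \<delta> * I t"
      using T(1)[OF that] assms by (intro mult_left_mono) auto
    finally show ?thesis
      using T(2)[OF that] by (simp add: B_def distrib_right)
  qed
  define q where "q s = f (M * J s)" for s
  have J_cont: "continuous_on {T..} J"
    using continuous_on_J \<open>T \<ge> 0\<close> by (intro continuous_on_atLeast)
  have q_cont: "continuous_on {T..} q"
    unfolding q_def
    by (rule continuous_on_compose2[OF f_cont]) (use T \<open>M > 0\<close> J_cont in \<open>auto intro!: continuous_intros\<close>)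
  have q_int: "q integrable_on {T..t}" for t
    by (intro integrable_continuous_interval continuous_on_subset[OF q_cont]) auto
  \<comment> \<open>\<open>Ht\<close> may jump, so \<open>J\<close> need not be differentiable; \<open>p\<close> is a differentiable minorant.\<close>
  define p where "p t = J T + integral {T..t} q" for t
  have p_le: "p t \<le> J t" if "t \<ge> T" for t
  proof -
    have "integral {T..t} q \<le> integral {T..t} (\<lambda>s. ext_at_0 f (K * Ht s))"
    proof (rule integral_le[OF q_int integrable_ext_Ht[OF \<open>T \<ge> 0\<close>]])
      fix s assume "s \<in> {T..t}"
      then have s: "s \<ge> T" by simp
      have "M * J s \<le> K * Ht s"
        using T(3)[OF s] T(5)[OF s] K_gt_1 mult_right_mono[of 1 K "Ht s"] by linarith
      then show "q s \<le> ext_at_0 f (K * Ht s)"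
        using T(4,5)[OF s] \<open>M > 0\<close> by (auto simp: q_def ext_Ht_eq intro!: f_le)
    qed
    then show ?thesis
      using J_diff[OF \<open>T \<ge> 0\<close> that] by (simp add: p_def)
  qed
  have p_pos: "p t > 0" if "t \<ge> T" for t
  proof -
    have "0 \<le> integral {T..t} q"
      by (rule integral_nonneg[OF q_int]) (use T \<open>M > 0\<close> in \<open>auto simp: q_def intro!: less_imp_le f_pos\<close>)
    then show ?thesis using T(4)[of T] by (simp add: p_def)
  qed
  have "eventually (\<lambda>t. B * I t < M * p t) at_top"
  proof (rule eventually_less_if_deriv_separated[OF f_cont f_pos])
    \<comment> \<open>Starting at \<open>T + 1\<close> keeps \<open>t\<close> strictly inside the
      range of integration, where the derivatives are two-sided.\<close>
    fix t assume "t \<ge> T + 1"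
    then have t: "t > T" by simp
    show "M * p t > 0" using p_pos t \<open>M > 0\<close> by simp
    show "((\<lambda>t. M * p t) has_real_derivative M * q t) (at t)"
      unfolding p_def using integral_has_real_derivative_at[OF q_cont t]
      by (auto intro!: derivative_eq_intros)
    \<comment> \<open>\<open>q\<close> is built from \<open>J\<close>; since
      \<open>p \<le> J\<close> and \<open>f\<close> is monotone, \<open>p\<close> satisfies a
      differential inequality in terms of itself.\<close>
    show "M * q t \<ge> M * f (M * p t)"
      using p_le[of t] p_pos[of t] t \<open>M > 0\<close> by (auto simp: q_def intro!: mult_left_mono f_le)
    show "B * I t > 0" using I_pos t \<open>B > 0\<close> by simp
    show "((\<lambda>t. B * I t) has_real_derivative B * f (x t)) (at t)"
      unfolding I_def using integral_has_real_derivative_at[OF continuous_on_f_x, of t] t \<open>T \<ge> 0\<close>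
      by (auto intro!: derivative_eq_intros)
    show "B * f (x t) \<le> B * f (B * I t)"
      using x_le_BI[of t] x_pos[of t] t \<open>T \<ge> 0\<close> \<open>B > 0\<close> by (auto intro!: mult_left_mono f_le)
  qed (use \<open>B < M\<close> in auto)
  \<comment> \<open>The constant is fitted to the closing chain
    \<open>M * p \<le> M * J \<le> B * \<delta> * Ht \<le> B * I\<close>, which contradicts the
    comparison just obtained.\<close>
  moreover have "eventually (\<lambda>t. J t \<le> B * \<delta> / M * Ht t) at_top"
    using \<open>B > 0\<close> \<open>M > 0\<close> \<open>\<delta> > 0\<close> by (intro J_le_Ht) simp
  ultimately have "eventually (\<lambda>t. B * I t < M * p t \<and> J t \<le> B * \<delta> / M * Ht t \<and> T \<le> t) at_top"
    using eventually_ge_at_top[of T] by eventually_elim simp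
  then obtain t where t: "B * I t < M * p t" "J t \<le> B * \<delta> / M * Ht t" "T \<le> t"
    using eventually_happens'[of at_top] trivial_limit_at_top_linorder by blast
  have "M * p t \<le> M * J t"
    using p_le[OF t(3)] \<open>M > 0\<close> by simp
  also have "\<dots> \<le> B * (\<delta> * Ht t)"
    using t(2) \<open>M > 0\<close> by (simp add: field_simps)
  also have "\<dots> \<le> B * I t"
    using T(1)[OF t(3)] \<open>B > 0\<close> by simp
  finally show False using t(1) by simp
qed

text \<open>A continuation argument: while \<open>\<phi> \<le> \<kappa>\<close> the bound
  \<open>x \<le> K * Ht\<close> holds, and under that bound \<open>I\<close> gains no more than
  \<open>J\<close>, so in fact \<open>\<phi> \<le> 0\<close>. Hence \<open>\<phi>\<close> never
  reaches \<open>\<kappa>\<close>. The barrier is placed on \<open>\<phi>\<close> because it is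
  continuous, whereas \<open>Ht\<close> may jump.\<close>

lemma x_eventually_le:
  assumes "d > 0" "1 + d \<le> K" and x_le: "eventually (\<lambda>t. x t \<le> (1 + d / 4) * Ht t + I t) at_top"
  shows "eventually (\<lambda>t. x t \<le> K * Ht t) at_top"
proof -
  have "eventually (\<lambda>t. x t \<le> (1 + d / 4) * Ht t + I t \<and> J t \<le> d / 4 * Ht t \<and> 0 < Ht t) at_top"
    using x_le J_le_Ht[of "d / 4"] Ht_eventually_pos \<open>d > 0\<close> by (auto intro: eventually_conj)
  then obtain T0 where T0: "\<forall>t\<ge>T0. x t \<le> (1 + d / 4) * Ht t + I t \<and> J t \<le> d / 4 * Ht t \<and> 0 < Ht t"
    unfolding eventually_at_top_linorder by blast
  have "frequently (\<lambda>t. I t \<le> d / 4 * Ht t) at_top"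
    using \<open>d > 0\<close> by (intro I_frequently_small[OF _ _ x_le]) auto
  then obtain T where "T \<ge> max 0 T0" and I_T: "I T \<le> d / 4 * Ht T"
    unfolding frequently_def eventually_at_top_linorder by blast
  then have "T \<ge> 0" and T: "\<And>t. t \<ge> T \<Longrightarrow> x t \<le> (1 + d / 4) * Ht t + I t"
    "\<And>t. t \<ge> T \<Longrightarrow> J t \<le> d / 4 * Ht t" "\<And>t. t \<ge> T \<Longrightarrow> 0 < Ht t"
    using T0 by auto
  define \<phi> where "\<phi> t = I t - I T - (J t - J T)" for t
  define \<kappa> where "\<kappa> = d / 4 * Ht T"
  have "\<kappa> > 0" using T(3)[of T] \<open>d > 0\<close> by (simp add: \<kappa>_def)
  \<comment> \<open>The slack \<open>d\<close> is spent in quarters of \<open>Ht t\<close>: one in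
    the assumed bound on \<open>x\<close>, and one each for \<open>I T\<close>, \<open>J t\<close>
    and \<open>\<kappa>\<close>.\<close>
  have x_le_K: "x t \<le> K * Ht t" if "t \<ge> T" "\<phi> t \<le> \<kappa>" for t
  proof -
    have "d / 4 * Ht T \<le> d / 4 * Ht t"
      using Ht_le[OF \<open>T \<ge> 0\<close> that(1)] \<open>d > 0\<close> by (intro mult_left_mono) auto
    then have "I t \<le> 3 * (d / 4 * Ht t)"
      using that I_T T(2)[OF that(1)] J_nonneg[OF \<open>T \<ge> 0\<close>] unfolding \<phi>_def \<kappa>_def by linarith
    then have "x t \<le> (1 + d) * Ht t"
      using T(1)[OF that(1)] by (simp add: algebra_simps)
    also have "\<dots> \<le> K * Ht t"
      using assms T(3)[OF that(1)] by (intro mult_right_mono) auto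
    finally show ?thesis .
  qed
  have "\<phi> t < \<kappa>" if "t \<ge> T" for t
  proof (rule ccontr)
    assume "\<not> \<phi> t < \<kappa>"
    moreover have "continuous_on {T..t} \<phi>"
      unfolding \<phi>_def using \<open>T \<ge> 0\<close> by (intro continuous_intros continuous_on_I continuous_on_J)
    moreover have "\<phi> T < \<kappa>" using \<open>\<kappa> > 0\<close> by (simp add: \<phi>_def)
    ultimately obtain \<tau> where \<tau>: "T \<le> \<tau>" "\<phi> \<tau> = \<kappa>" "\<And>s. T \<le> s \<Longrightarrow> s \<le> \<tau> \<Longrightarrow> \<phi> s \<le> \<kappa>"
      using first_crossing[of T t \<phi> \<kappa>] \<open>t \<ge> T\<close> by (metis not_less)
    have "integral {T..\<tau>} (\<lambda>s. f (x s)) \<le> integral {T..\<tau>} (\<lambda>s. ext_at_0 f (K * Ht s))"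
      using x_le_K \<tau>(3) T(3) \<open>T \<ge> 0\<close> x_pos
      by (intro integral_le integrable_f_x integrable_ext_Ht) (auto simp: ext_Ht_eq intro!: f_le)
    then have "\<phi> \<tau> \<le> 0"
      using I_diff[OF \<open>T \<ge> 0\<close> \<tau>(1)] J_diff[OF \<open>T \<ge> 0\<close> \<tau>(1)] by (simp add: \<phi>_def)
    then show False using \<tau>(2) \<open>\<kappa> > 0\<close> by simp
  qed
  then show ?thesis
    using x_le_K unfolding eventually_at_top_linorder by (meson less_imp_le)
qed

text \<open>From some \<open>T\<close> on, \<open>J\<close> dominates the growth of
  \<open>I\<close>, and the constant \<open>I T\<close> vanishes relative to the divergent
  \<open>Ht\<close>.\<close>

lemma I_negligible:
  assumes "eventually (\<lambda>t. x t \<le> K * Ht t) at_top"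
  shows "((\<lambda>t. I t / Ht t) \<longlongrightarrow> 0) at_top"
proof -
  obtain T0 where "\<forall>t\<ge>T0. x t \<le> K * Ht t \<and> 0 < Ht t"
    using eventually_conj[OF assms Ht_eventually_pos] unfolding eventually_at_top_linorder by blast
  then obtain T where "T \<ge> 0" and T: "\<And>t. t \<ge> T \<Longrightarrow> x t \<le> K * Ht t" "\<And>t. t \<ge> T \<Longrightarrow> 0 < Ht t"
    by (metis linorder_le_cases order_trans)
  have I_le: "I t \<le> I T + J t" if "t \<ge> T" for t
  proof -
    have "integral {T..t} (\<lambda>s. f (x s)) \<le> integral {T..t} (\<lambda>s. ext_at_0 f (K * Ht s))"
      using T \<open>T \<ge> 0\<close> x_pos
      by (intro integral_le integrable_f_x integrable_ext_Ht) (auto simp: ext_Ht_eq intro!: f_le)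
    then show ?thesis
      using I_diff[OF \<open>T \<ge> 0\<close> that] J_diff[OF \<open>T \<ge> 0\<close> that] J_nonneg[OF \<open>T \<ge> 0\<close>] by simp
  qed
  have "((\<lambda>t. I T / Ht t + J t / Ht t) \<longlongrightarrow> 0 + 0) at_top"
    by (intro tendsto_add J_negligible real_tendsto_divide_at_top[OF tendsto_const Ht_at_top])
  then have lim: "((\<lambda>t. I T / Ht t + J t / Ht t) \<longlongrightarrow> 0) at_top" by simp
  show ?thesis
  proof (rule tendsto_sandwich[OF _ _ tendsto_const lim])
    show "eventually (\<lambda>t. 0 \<le> I t / Ht t) at_top"
      using eventually_ge_at_top[of 0] by eventually_elim (simp add: I_nonneg Ht_nonneg)
    show "eventually (\<lambda>t. I t / Ht t \<le> I T / Ht t + J t / Ht t) at_top"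
      using eventually_ge_at_top[of T]
    proof eventually_elim
      case (elim t)
      then show ?case
        using divide_right_mono[OF I_le, of t "Ht t"] T(2)[of t] by (simp add: add_divide_distrib)
    qed
  qed
qed

end

section \<open>Transfer to the differential equation and both implications\<close>

theorem theorem4:
  fixes f h H Ht x :: "real \<Rightarrow> real" and x0 \<psi> :: real
  assumes f_cont: "continuous_on {0<..} f"
    and f_pos: "\<And>y. y > 0 \<Longrightarrow> f y > 0"
    and f_mono: "mono_on {0<..} f"
    and f_lipschitz: "local_lipschitz (UNIV :: real set) {0<..} (\<lambda>_. f)"
    and x0_pos: "x0 > 0"
    and f_ratio_mono: "mono_on {x0..} (\<lambda>y. f y / y)"
    and f_ratio_lim: "filterlim (\<lambda>y. f y / y) at_top at_top"
    and f_osgood: "filterlim (\<lambda>T. integral {1..T} (\<lambda>u. 1 / f u)) at_top at_top"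
    and h_cont: "continuous_on {0<..} h"
    and H_int: "\<And>t. t \<ge> 0 \<Longrightarrow> (h has_integral H t) {0..t}"
    and H_nonneg: "\<And>t. t \<ge> 0 \<Longrightarrow> H t \<ge> 0"
    and psi_pos: "\<psi> > 0"
    and sol: "is_solution f H \<psi> x"
    and Ht_nonneg: "\<And>t. t \<ge> 0 \<Longrightarrow> Ht t \<ge> 0"
    and Ht_mono: "mono_on {0..} Ht"
    and H_asymp: "((\<lambda>t. H t / Ht t) \<longlongrightarrow> 1) at_top"
  shows "((\<exists>K>1. ((\<lambda>t. integral {0..t} (\<lambda>s. ext_at_0 f (K * Ht s)) / Ht t) \<longlongrightarrow> 0) at_top)
            \<longrightarrow> ((\<lambda>t. x t / H t) \<longlongrightarrow> 1) at_top) \<and>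
         (((\<lambda>t. x t / H t) \<longlongrightarrow> 1) at_top
            \<longrightarrow> ((\<lambda>t. integral {0..t} (\<lambda>s. ext_at_0 f (H s)) / H t) \<longlongrightarrow> 0) at_top)"
proof (intro conjI impI)
  have x_cont: "continuous_on {0..} x" and x_pos: "\<And>t. t \<ge> 0 \<Longrightarrow> x t > 0"
    and x_eq: "\<And>t. t \<ge> 0 \<Longrightarrow> x t = \<psi> + H t + integral {0..t} (\<lambda>s. f (x s))"
    using sol by (auto simp: is_solution_def)
  \<comment> \<open>A quotient by 0 is 0, so an eventually positive ratio of nonnegative functions
    forces both to be positive.\<close>
  have H_Ht_pos: "eventually (\<lambda>t. 0 < H t \<and> 0 < Ht t) at_top"
    using order_tendstoD(1)[OF H_asymp zero_less_one] eventually_ge_at_top[of 0]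
    by eventually_elim (use H_nonneg Ht_nonneg in \<open>force simp: zero_less_divide_iff\<close>)
  {
    assume "\<exists>K>1. ((\<lambda>t. integral {0..t} (\<lambda>s. ext_at_0 f (K * Ht s)) / Ht t) \<longlongrightarrow> 0) at_top"
    then obtain K where "K > 1"
      and K: "((\<lambda>t. integral {0..t} (\<lambda>s. ext_at_0 f (K * Ht s)) / Ht t) \<longlongrightarrow> 0) at_top"
      by blast
    interpret dominated_solution f x Ht K "\<lambda>t. integral {0..t} (\<lambda>s. f (x s))"
      "\<lambda>t. integral {0..t} (\<lambda>s. ext_at_0 f (K * Ht s))"
      by unfold_locales
        (use f_cont f_pos f_mono x_cont x_pos Ht_nonneg Ht_mono H_Ht_pos \<open>K > 1\<close> K in
          \<open>auto elim: eventually_mono\<close>)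
    define I where "I t = integral {0..t} (\<lambda>s. f (x s))" for t
    define d where "d = K - 1"
    have "d > 0" using \<open>K > 1\<close> by (simp add: d_def)
    have psi_lim: "((\<lambda>t. \<psi> / Ht t) \<longlongrightarrow> 0) at_top"
      by (rule real_tendsto_divide_at_top[OF tendsto_const Ht_at_top])
    \<comment> \<open>The eighths for \<open>H\<close> and for \<open>\<psi>\<close> add up to the
      \<open>d / 4\<close> allowed in \<open>x_eventually_le\<close>.\<close>
    have "eventually (\<lambda>t. H t / Ht t < 1 + d / 8) at_top"
      using order_tendstoD(2)[OF H_asymp] \<open>d > 0\<close> by simp
    moreover have "eventually (\<lambda>t. \<psi> / Ht t < d / 8) at_top"
      using \<open>d > 0\<close> by (intro order_tendstoD(2)[OF psi_lim]) simp
    ultimately have "eventually (\<lambda>t. x t \<le> (1 + d / 4) * Ht t + I t) at_top"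
      using H_Ht_pos eventually_ge_at_top[of 0]
      by eventually_elim (simp add: x_eq I_def field_simps)
    then have "eventually (\<lambda>t. x t \<le> K * Ht t) at_top"
      unfolding I_def by (intro x_eventually_le[OF \<open>d > 0\<close>]) (simp_all add: d_def)
    then have "((\<lambda>t. I t / Ht t) \<longlongrightarrow> 0) at_top"
      unfolding I_def by (rule I_negligible)
    \<comment> \<open>This rewrites \<open>x / H = 1 + (\<psi> + I) / H\<close> with every term
      measured against \<open>Ht\<close>; the denominator \<open>H / Ht\<close> tends to 1.\<close>
    then have "((\<lambda>t. 1 + (\<psi> / Ht t + I t / Ht t) / (H t / Ht t)) \<longlongrightarrow> 1 + (0 + 0) / 1) at_top"
      by (intro tendsto_intros psi_lim H_asymp) simp_all
    moreover have "eventually (\<lambda>t. 1 + (\<psi> / Ht t + I t / Ht t) / (H t / Ht t) = x t / H t) at_top"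
      using H_Ht_pos eventually_ge_at_top[of 0]
      by eventually_elim (simp add: x_eq I_def field_simps)
    ultimately show "((\<lambda>t. x t / H t) \<longlongrightarrow> 1) at_top"
      by (simp add: tendsto_cong)
  }
  {
    assume x_H: "((\<lambda>t. x t / H t) \<longlongrightarrow> 1) at_top"
    have fx_int: "(\<lambda>s. f (x s)) integrable_on {0..t}" for t
      by (intro integrable_continuous_interval continuous_on_compose2[OF f_cont]
          continuous_on_subset[OF x_cont]) (use x_pos in auto)
    have fx_nonneg: "0 \<le> integral {0..t} (\<lambda>s. f (x s))" for t
      by (rule integral_nonneg[OF fx_int]) (use x_pos f_pos in \<open>auto intro: less_imp_le\<close>)
    have H_le_x: "H t \<le> x t" if "t \<ge> 0" for t
      using x_eq[OF that] fx_nonneg[of t] psi_pos by simp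
    have fH_nonneg: "0 \<le> ext_at_0 f (H s)" if "s \<ge> 0" for s
      using ext_at_0_nonneg[OF f_pos f_mono] H_nonneg that by simp
    have fH_le: "ext_at_0 f (H s) \<le> f (x s)" if "s \<ge> 0" for s
      using mono_onD[OF mono_on_ext_at_0[OF f_pos f_mono], of "H s" "x s"]
        H_nonneg[OF that] H_le_x[OF that] x_pos[OF that] by (simp add: ext_at_0_def)
    \<comment> \<open>If \<open>f \<circ> H\<close> were not integrable, its integral would be \<open>0\<close> and both bounds would hold trivially.\<close>
    have int_nonneg: "0 \<le> integral {0..t} (\<lambda>s. ext_at_0 f (H s))" for t
      using integral_nonneg[of "\<lambda>s. ext_at_0 f (H s)" "{0..t}"] fH_nonneg
      by (cases "(\<lambda>s. ext_at_0 f (H s)) integrable_on {0..t}") (auto simp: not_integrable_integral)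
    have int_le: "integral {0..t} (\<lambda>s. ext_at_0 f (H s)) \<le> integral {0..t} (\<lambda>s. f (x s))" for t
      using integral_le[OF _ fx_int, of "\<lambda>s. ext_at_0 f (H s)" t] fH_le fx_nonneg
      by (cases "(\<lambda>s. ext_at_0 f (H s)) integrable_on {0..t}") (auto simp: not_integrable_integral)
    \<comment> \<open>The upper function of the sandwich: \<open>x / H - 1\<close> equals
      \<open>(\<psi> + I) / H\<close> for positive \<open>H\<close>, where \<open>I\<close> is the
      integral of \<open>f (x s)\<close>, and \<open>I\<close> dominates the integral of
      \<open>f\<close> along \<open>H\<close>.\<close>
    have lim: "((\<lambda>t. x t / H t - 1) \<longlongrightarrow> 0) at_top"
      using tendsto_diff[OF x_H tendsto_const[of 1]] by simp
    show "((\<lambda>t. integral {0..t} (\<lambda>s. ext_at_0 f (H s)) / H t) \<longlongrightarrow> 0) at_top"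
    proof (rule tendsto_sandwich[OF _ _ tendsto_const lim])
      show "eventually (\<lambda>t. 0 \<le> integral {0..t} (\<lambda>s. ext_at_0 f (H s)) / H t) at_top"
        using H_Ht_pos by eventually_elim (simp add: int_nonneg)
      show "eventually (\<lambda>t. integral {0..t} (\<lambda>s. ext_at_0 f (H s)) / H t \<le> x t / H t - 1) at_top"
        using H_Ht_pos eventually_ge_at_top[of 0]
      proof eventually_elim
        case (elim t)
        then have "integral {0..t} (\<lambda>s. ext_at_0 f (H s)) \<le> x t - H t"
          using int_le[of t] x_eq[of t] psi_pos by simp
        with elim show ?case by (simp add: field_simps)
      qed
    qed
  }
qed

end
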